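(* Let $n$ and $\ell$ be integers with $1\leq \ell\leq n$, and let $K_{n,n+\ell}$ be the complete bipartite graph with parts of sizes $n$ and $n+\ell$. Then $$\mathrm{va}_2^{\equiv}(K_{n,n+\ell})\leq 2\left\lfloor \frac{n+\ell+1}{3}\right\rfloor .$$ Moreover, the bound is sharp: there exist integers $n,\ell$ with $1\le \ell\le n$ for which equality holds.
   Context: All graphs are finite and simple. For a positive integer $t$, a $t$-coloring of a graph $G$ is any map $f:V(G)\to\{1,\dots,t\}$ (not necessarily proper), with color classes $V_i=f^{-1}(i)$ (possibly empty). It is equitable if $||V_i|-|V_j||\le 1$ for all $i,j$. For a nonnegative integer $k$, a $(t,k)$-tree-coloring is a $t$-coloring such that every component of each induced subgraph $G[V_i]$ is a tree of maximum degree at most $k$ (i.e. each $G[V_i]$ is a forest of maximum degree at most $k$). An equitable $(t,k)$-tree-coloring is a $(t,k)$-tree-coloring that is equitable. The strong equitable vertex $k$-arboricity $\mathrm{va}_k^{\equiv}(G)$ is the smallest positive integer $t$ such that $G$ has an equitable $(t',k)$-tree-coloring for every integer $t'\ge t$. *)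

theory Defs
  imports "Graph_Theory.Graph_Theory"
begin

text \<open>
  Finite simple graphs are the symmetric, loop-free digraphs without parallel arcs of the locale
  \<^locale>\<open>graph\<close>: every edge is represented by a pair of opposite arcs. For such graphs the
  components are the strongly connected components, and the degree of a vertex is its out-degree.
  The library predicates \<^const>\<open>forest\<close> and \<^const>\<open>tree\<close> are unsuitable here, since a pair of
  opposite arcs is a directed cycle of length 2; a cycle of an undirected simple graph is a
  directed cycle of length at least 3.
\<close>

definition undirected_tree :: "('a, 'b) pre_digraph \<Rightarrow> bool" where
  "undirected_tree G \<longleftrightarrow>
     Digraph_Component.connected G \<and> \<not> (\<exists>p. pre_digraph.cycle G p \<and> 3 \<le> length p)"

definition color_class :: "('a, 'b) pre_digraph \<Rightarrow> ('a \<Rightarrow> nat) \<Rightarrow> nat \<Rightarrow> 'a set" where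
  "color_class G f i = {v \<in> verts G. f v = i}"

definition coloring :: "('a, 'b) pre_digraph \<Rightarrow> nat \<Rightarrow> ('a \<Rightarrow> nat) \<Rightarrow> bool" where
  "coloring G t f \<longleftrightarrow> f ` verts G \<subseteq> {1..t}"

definition equitable :: "('a, 'b) pre_digraph \<Rightarrow> nat \<Rightarrow> ('a \<Rightarrow> nat) \<Rightarrow> bool" where
  "equitable G t f \<longleftrightarrow>
     (\<forall>i \<in> {1..t}. \<forall>j \<in> {1..t}.
        \<bar>int (card (color_class G f i)) - int (card (color_class G f j))\<bar> \<le> 1)"

definition tree_coloring :: "('a, 'b) pre_digraph \<Rightarrow> nat \<Rightarrow> nat \<Rightarrow> ('a \<Rightarrow> nat) \<Rightarrow> bool" where
  "tree_coloring G t k f \<longleftrightarrow> coloring G t f \<and>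
     (\<forall>i \<in> {1..t}. \<forall>H \<in> pre_digraph.sccs (G \<restriction> color_class G f i).
        undirected_tree H \<and> (\<forall>v \<in> verts H. out_degree H v \<le> k))"

definition strong_equitable_vertex_arboricity :: "nat \<Rightarrow> ('a, 'b) pre_digraph \<Rightarrow> nat" where
  "strong_equitable_vertex_arboricity k G =
     (LEAST t. 0 < t \<and> (\<forall>t' \<ge> t. \<exists>f. tree_coloring G t' k f \<and> equitable G t' f))"

text \<open>The minimum exists, as an injective coloring is an equitable tree-coloring.\<close>

lemma strong_equitable_vertex_arboricity_exists:
  assumes "graph G"
  shows "\<exists>t > 0. \<forall>t' \<ge> t. \<exists>f. tree_coloring G t' k f \<and> equitable G t' f"
proof (intro exI[of _ "Suc (card (verts G))"] conjI allI impI)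
  fix t' assume t': "Suc (card (verts G)) \<le> t'"
  interpret graph G by fact
  obtain g where g: "inj_on g (verts G)" "g ` verts G \<subseteq> {1..t'}"
    using t' card_le_inj[of "verts G" "{1..t'}"] by auto
  have class_le: "card (color_class G g i) \<le> 1" for i
    using g(1) by (auto simp: color_class_def card_le_Suc0_iff_eq inj_on_def)
  have tree: "undirected_tree H \<and> (\<forall>v \<in> verts H. out_degree H v \<le> k)"
    if H: "H \<in> pre_digraph.sccs (G \<restriction> color_class G g i)" for i H
  proof -
    have sub: "induced_subgraph H (G \<restriction> color_class G g i)" and sc: "strongly_connected H"
      using H by (auto simp: pre_digraph.sccs_def)
    have vs: "verts H \<subseteq> color_class G g i"
      and th: "tail H = tail G" "head H = head G" and ah: "arcs H \<subseteq> arcs G" and wf: "wf_digraph H"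
      using sub by (auto simp: induced_subgraph_def subgraph_def compatible_def)
    interpret H: wf_digraph H by fact
    have no_arcs: "arcs H = {}"
    proof (rule ccontr)
      assume "arcs H \<noteq> {}"
      then obtain e where e: "e \<in> arcs H" by auto
      have "tail H e \<in> verts H" "head H e \<in> verts H" using e by auto
      then have "tail G e = head G e"
        using vs th g(1) by (auto simp: color_class_def inj_on_def)
      then show False using e ah no_loops by auto
    qed
    have conn: "Digraph_Component.connected H"
      using sc no_arcs
      by (auto simp: connected_def strongly_connected_def mk_symmetric_def reachable_def
          arcs_ends_def)
    have "\<not> H.cycle p" for p
      using no_arcs by (cases p) (auto simp: H.cycle_def H.awalk_def)
    then show ?thesis
      using conn no_arcs by (auto simp: undirected_tree_def out_degree_def out_arcs_def)
  qed
  have "\<bar>int (card (color_class G g i)) - int (card (color_class G g j))\<bar> \<le> 1" for i j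
    using class_le[of i] class_le[of j] by linarith
  then show "\<exists>f. tree_coloring G t' k f \<and> equitable G t' f"
    using g tree by (auto simp: tree_coloring_def coloring_def equitable_def intro!: exI[of _ g])
qed simp

end

theory Submission
  imports Defs
begin

text \<open>
  In a bipartite graph every set of at most three vertices induces a forest of maximum degree at
  most 2. Hence for \<open>2n + l \<le> 3t\<close> any equitable \<open>t\<close>-coloring is a tree-coloring. From the bound on
  this inequality fails only if \<open>l = 1\<close>, \<open>n = 3m\<close> and \<open>t = 2m\<close>; in this case the two sides, of sizes
  \<open>3m\<close> and \<open>3m + 1\<close>, are separately split into \<open>m\<close> classes of size 3 or 4, which are independent.
  The bound is attained by \<open>K\<^bsub>2,3\<^esub>\<close>, which is not itself a tree of maximum degree at most 2.
\<close>

section \<open>Balanced partitions of a finite set\<close>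

text \<open>Number the elements from 0 and take residues modulo \<open>t\<close>. The upper bound is
  the ceiling of \<open>card S / t\<close>.\<close>

lemma exists_balanced_map:
  fixes S :: "'a set" and t :: nat
  assumes "finite S" "0 < t"
  shows "\<exists>f. f ` S \<subseteq> {..<t} \<and>
    (\<forall>i<t. card S div t \<le> card {v \<in> S. f v = i} \<and>
            card {v \<in> S. f v = i} \<le> (card S + t - 1) div t)"
proof -
  obtain h where h: "bij_betw h S {0..<card S}"
    using ex_bij_betw_finite_nat[OF assms(1)] by blast
  have img: "(\<lambda>v. h v mod t) ` S \<subseteq> {..<t}"
    using assms(2) by auto
  have bounds: "card S div t \<le> card {v \<in> S. h v mod t = i} \<and>
      card {v \<in> S. h v mod t = i} \<le> (card S + t - 1) div t" if i: "i < t" for i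
  proof -
    let ?X = "{x. x < card S \<and> x mod t = i}"
    have "h ` {v \<in> S. h v mod t = i} = ?X"
      using h by (fastforce simp: bij_betw_def)
    moreover have "inj_on h {v \<in> S. h v mod t = i}"
      using h by (auto simp: bij_betw_def inj_on_def)
    ultimately have eq: "card {v \<in> S. h v mod t = i} = card ?X"
      by (simp flip: card_image)
    \<comment> \<open>Within a fixed residue class a number is determined by its quotient, so the
      class can be counted by its quotients.\<close>
    have inj: "inj_on (\<lambda>x. x div t) ?X"
      by (rule inj_onI) (metis (mono_tags, lifting) div_mult_mod_eq mem_Collect_eq)
    have "(\<lambda>x. x div t) ` ?X \<subseteq> {..<(card S + t - 1) div t}"
    proof
      fix q assume "q \<in> (\<lambda>x. x div t) ` ?X"
      then obtain x where x: "x < card S" "q = x div t" by auto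
      \<comment> \<open>Adding \<open>t\<close> raises the quotient by one, which turns this into
        the strict inequality for \<open>q\<close>.\<close>
      have "(x + t) div t \<le> (card S + t - 1) div t"
        using x by (intro div_le_mono) auto
      then show "q \<in> {..<(card S + t - 1) div t}"
        using x assms(2) by simp
    qed
    then have upper: "card ?X \<le> (card S + t - 1) div t"
      using card_inj_on_le[OF inj _ finite_lessThan] by simp
    have "{..<card S div t} \<subseteq> (\<lambda>x. x div t) ` ?X"
    proof
      fix q assume "q \<in> {..<card S div t}"
      then have "Suc q * t \<le> card S"
        using assms(2) by (metis Suc_leI lessThan_iff less_eq_div_iff_mult_less_eq)
      then have "q * t + i < card S" using i by simp
      then show "q \<in> (\<lambda>x. x div t) ` ?X"
        using i assms(2) by (intro image_eqI[of _ _ "q * t + i"]) auto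
    qed
    then have "card S div t \<le> card ?X"
      using surj_card_le[of ?X "{..<card S div t}"] by fastforce
    with upper eq show ?thesis by simp
  qed
  show ?thesis using img bounds by (intro exI[of _ "\<lambda>v. h v mod t"]) auto
qed

section \<open>Components induced by color classes\<close>

text \<open>Strong connectivity gives connectivity because reachability persists when arcs are
  symmetrized. This settles one half of \<open>undirected_tree\<close>, leaving only cycles and
  degrees to check.\<close>

lemma sccs_induce_subgraphD:
  assumes "graph G" "S \<subseteq> verts G" "H \<in> pre_digraph.sccs (G \<restriction> S)"
  shows "digraph H" "Digraph_Component.connected H" "verts H \<subseteq> S" "arcs H \<subseteq> arcs G"
    "tail H = tail G" "head H = head G"
proof -
  interpret graph G by fact
  have ind: "induced_subgraph H (G \<restriction> S)" and sc: "strongly_connected H"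
    using assms(3) by (auto simp: pre_digraph.sccs_def)
  then show "verts H \<subseteq> S" "arcs H \<subseteq> arcs G" "tail H = tail G" "head H = head G"
    by (auto simp: induced_subgraph_def subgraph_def compatible_def)
  interpret GS: digraph "G \<restriction> S"
    using assms(2) by (intro digraphI_induced induced_induce)
  show dH: "digraph H" using ind by (rule GS.digraphI_induced)
  interpret H: digraph H by (fact dH)
  show "Digraph_Component.connected H"
    using sc H.reachable_mk_symmetricI by (auto simp: connected_def strongly_connected_def)
qed

text \<open>Without parallel arcs \<open>head\<close> is injective on the arcs leaving
  \<open>v\<close>, and without loops it never takes the value \<open>v\<close>.\<close>

lemma (in digraph) out_degree_less_card_verts:
  assumes "v \<in> verts G"
  shows "out_degree G v < card (verts G)"
proof -
  have "inj_on (head G) (out_arcs G v)"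
    by (rule inj_onI) (auto intro!: no_multi_arcs simp: arc_to_ends_def)
  moreover have "head G ` out_arcs G v \<subseteq> verts G - {v}"
    using no_loops by force
  ultimately have "out_degree G v \<le> card (verts G - {v})"
    unfolding out_degree_def by (intro card_inj_on_le) auto
  also have "\<dots> < card (verts G)"
    using assms by (intro psubset_card_mono) auto
  finally show ?thesis .
qed

lemma (in fin_digraph) cycle_length_le_card_verts:
  assumes "cycle p"
  shows "length p \<le> card (verts G)"
proof -
  obtain u where u: "awalk u p u" "distinct (tl (awalk_verts u p))"
    using assms by (auto simp: cycle_def)
  \<comment> \<open>\<open>tl\<close> drops the repeated start of the closed walk, leaving one
    distinct vertex per arc.\<close>
  have "set (tl (awalk_verts u p)) \<subseteq> verts G"
    using u(1) awalk_verts_in_verts[of u p] by (auto simp: awalk_def dest: list.set_sel(2)[rotated])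
  then have "card (set (tl (awalk_verts u p))) \<le> card (verts G)"
    by (intro card_mono) auto
  then show ?thesis
    using u(2) by (simp add: distinct_card length_awalk_verts)
qed

text \<open>Three vertices leave room for degree at most 2, and the only possible cycle of length at
  least 3 is a triangle, which is odd.\<close>

lemma small_bipartite_component:
  assumes G: "graph G" and S: "S \<subseteq> verts G" "card S \<le> 3"
    and UV: "U \<inter> V = {}" "arcs_ends G \<subseteq> U \<times> V \<union> V \<times> U"
    and H: "H \<in> pre_digraph.sccs (G \<restriction> S)"
  shows "undirected_tree H \<and> (\<forall>v \<in> verts H. out_degree H v \<le> 2)"
proof -
  note HG = sccs_induce_subgraphD[OF G S(1) H]
  interpret G: graph G by fact
  interpret H: digraph H by (fact HG(1))
  have "card (verts H) \<le> card S"
    using HG(3) S(1) by (meson G.finite_verts card_mono finite_subset)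
  with S(2) have card: "card (verts H) \<le> 3" by simp
  have "out_degree H v \<le> 2" if "v \<in> verts H" for v
    using H.out_degree_less_card_verts[OF that] card by linarith
  moreover have False if p: "H.cycle p" "3 \<le> length p" for p
  proof -
    have "length p = 3"
      using H.cycle_length_le_card_verts[OF p(1)] p(2) card by linarith
    then obtain a b c where abc: "p = [a, b, c]"
      by (auto simp: numeral_3_eq_3 length_Suc_conv)
    obtain u where "H.awalk u p u" using p(1) by (auto simp: H.cycle_def)
    then have arcs: "{a, b, c} \<subseteq> arcs G"
      and ends: "head G a = tail G b" "head G b = tail G c" "head G c = tail G a"
      using HG(4-6) by (auto simp: abc H.awalk_def)
    have "(tail G e, head G e) \<in> U \<times> V \<union> V \<times> U" if "e \<in> arcs G" for e
      using that UV(2) by (auto simp: arcs_ends_def arc_to_ends_def)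
    \<comment> \<open>Every arc switches sides, so three arcs end on the side opposite to the start
      and cannot close up.\<close>
    from this[of a] this[of b] this[of c] show False
      using arcs ends UV(1) by auto
  qed
  ultimately show ?thesis
    using HG(2) by (auto simp: undirected_tree_def)
qed

lemma independent_component:
  assumes G: "graph G" and S: "S \<subseteq> verts G" "arcs_ends G \<inter> S \<times> S = {}"
    and H: "H \<in> pre_digraph.sccs (G \<restriction> S)"
  shows "undirected_tree H \<and> (\<forall>v \<in> verts H. out_degree H v \<le> k)"
proof -
  note HG = sccs_induce_subgraphD[OF G S(1) H]
  interpret H: digraph H by (fact HG(1))
  have no_arcs: "arcs H = {}"
  proof (rule ccontr)
    assume "arcs H \<noteq> {}"
    then obtain e where e: "e \<in> arcs H" by auto
    then have "tail G e \<in> S" "head G e \<in> S" "e \<in> arcs G"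
      using HG(3-6) H.wellformed[OF e] by auto
    then have "(tail G e, head G e) \<in> arcs_ends G \<inter> S \<times> S"
      by (auto simp: arcs_ends_def arc_to_ends_def)
    with S(2) show False by auto
  qed
  have "\<not> H.cycle p" for p
    using no_arcs by (cases p) (auto simp: H.cycle_def H.awalk_def)
  with HG(2) no_arcs show ?thesis
    by (auto simp: undirected_tree_def out_degree_def out_arcs_def)
qed

section \<open>Two constructions of equitable tree-colorings\<close>

lemma equitableI:
  assumes "\<And>i. i \<in> {1..t} \<Longrightarrow> q \<le> card (color_class G f i) \<and> card (color_class G f i) \<le> Suc q"
  shows "equitable G t f"
  unfolding equitable_def
proof (intro ballI)
  fix i j assume "i \<in> {1..t}" "j \<in> {1..t}"
  from assms[OF this(1)] assms[OF this(2)]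
  show "\<bar>int (card (color_class G f i)) - int (card (color_class G f j))\<bar> \<le> 1"
    by linarith
qed

lemma equitable_tree_coloring_if_small_classes:
  assumes G: "graph G" and UV: "U \<inter> V = {}" "arcs_ends G \<subseteq> U \<times> V \<union> V \<times> U"
    and t: "0 < t" "card (verts G) \<le> 3 * t"
  shows "\<exists>f. tree_coloring G t 2 f \<and> equitable G t f"
proof -
  interpret graph G by fact
  let ?N = "card (verts G)"
  obtain f where f: "f ` verts G \<subseteq> {..<t}"
    "\<And>i. i < t \<Longrightarrow> ?N div t \<le> card {v \<in> verts G. f v = i} \<and>
            card {v \<in> verts G. f v = i} \<le> (?N + t - 1) div t"
    using exists_balanced_map[OF finite_verts t(1)] by blast
  \<comment> \<open>Colors start at 1, whereas the balanced map takes values from 0.\<close>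
  let ?g = "\<lambda>v. Suc (f v)"
  have cls: "color_class G ?g i = {v \<in> verts G. f v = i - 1}" if "i \<in> {1..t}" for i
    using that by (auto simp: color_class_def)
  have bounds: "?N div t \<le> card (color_class G ?g i) \<and>
      card (color_class G ?g i) \<le> (?N + t - 1) div t" if "i \<in> {1..t}" for i
    using f(2)[of "i - 1"] that by (auto simp: cls[OF that])
  have "(?N + t - 1) div t \<le> (?N + t) div t"
    by (intro div_le_mono) simp
  then have ceil: "(?N + t - 1) div t \<le> Suc (?N div t)"
    using t(1) by simp
  \<comment> \<open>From \<open>?N\<close> \<le> \<open>3 * t\<close> the numerator is at most
    \<open>4 * t - 1\<close>.\<close>
  have "(?N + t - 1) div t < 4"
    using t by (intro div_less_iff_less_mult[THEN iffD2]) auto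
  then have small: "card (color_class G ?g i) \<le> 3" if "i \<in> {1..t}" for i
    using bounds[OF that] by linarith
  have "equitable G t ?g"
    using bounds ceil by (intro equitableI[of t "?N div t"]) (meson le_trans)
  moreover have "coloring G t ?g"
    using f(1) by (auto simp: coloring_def)
  moreover have "color_class G ?g i \<subseteq> verts G" for i
    by (auto simp: color_class_def)
  ultimately show ?thesis
    using small_bipartite_component[OF G _ small UV]
    by (auto simp: tree_coloring_def intro!: exI[of _ ?g])
qed

text \<open>Each side is split evenly into \<open>m\<close> classes. The common \<open>q\<close>
  makes class sizes comparable across the two sides; each class lies within one side and so spans no
  arc, whence \<open>k\<close> is arbitrary.\<close>

lemma equitable_tree_coloring_if_independent_classes:
  assumes G: "graph G" and UV: "verts G = U \<union> V" "U \<inter> V = {}" "arcs_ends G \<subseteq> U \<times> V \<union> V \<times> U"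
    and m: "0 < m" "card U = q * m" "q * m \<le> card V" "card V \<le> Suc q * m"
  shows "\<exists>f. tree_coloring G (2 * m) k f \<and> equitable G (2 * m) f"
proof -
  interpret graph G by fact
  have fin: "finite U" "finite V" using finite_verts UV(1) by auto
  have "(card U + m - 1) div m < Suc (Suc q)" "(card V + m - 1) div m < Suc (Suc q)"
    using m by (auto intro!: div_less_iff_less_mult[THEN iffD2])
  moreover have "q \<le> card U div m" "q \<le> card V div m"
    using m by (auto simp: less_eq_div_iff_mult_less_eq)
  ultimately have q: "q \<le> card U div m" "(card U + m - 1) div m \<le> Suc q"
      "q \<le> card V div m" "(card V + m - 1) div m \<le> Suc q"
    by auto
  obtain f where f: "f ` U \<subseteq> {..<m}"
    "\<And>i. i < m \<Longrightarrow> q \<le> card {v \<in> U. f v = i} \<and> card {v \<in> U. f v = i} \<le> Suc q"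
    using exists_balanced_map[OF fin(1) m(1)] q(1,2) by (meson le_trans)
  obtain g where g: "g ` V \<subseteq> {..<m}"
    "\<And>i. i < m \<Longrightarrow> q \<le> card {v \<in> V. g v = i} \<and> card {v \<in> V. g v = i} \<le> Suc q"
    using exists_balanced_map[OF fin(2) m(1)] q(3,4) by (meson le_trans)
  \<comment> \<open>Colors 1 to \<open>m\<close> are for \<open>U\<close>, colors
    \<open>m + 1\<close> to \<open>2 * m\<close> for \<open>V\<close>.\<close>
  let ?h = "\<lambda>v. if v \<in> U then Suc (f v) else Suc (m + g v)"
  have cls: "color_class G ?h i =
      (if i \<le> m then {v \<in> U. f v = i - 1} else {v \<in> V. g v = i - m - 1})"
    if "i \<in> {1..2 * m}" for i
    using that f(1) g(1) UV(1,2) by (auto simp: color_class_def)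
  have eq: "equitable G (2 * m) ?h"
    using f(2) g(2) by (intro equitableI[of _ q]) (auto simp: cls)
  have "coloring G (2 * m) ?h"
    using f(1) g(1) UV(1) by (force simp: coloring_def)
  moreover have "color_class G ?h i \<subseteq> verts G" for i
    by (auto simp: color_class_def)
  moreover have "arcs_ends G \<inter> color_class G ?h i \<times> color_class G ?h i = {}"
    if "i \<in> {1..2 * m}" for i
    using UV(2,3) by (auto simp: cls[OF that])
  ultimately have "tree_coloring G (2 * m) k ?h"
    unfolding tree_coloring_def by (intro conjI[OF _ ballI[OF ballI]] independent_component[OF G])
  with eq show ?thesis by blast
qed

section \<open>The upper bound\<close>

lemma strong_equitable_vertex_arboricity_complete_bipartite_le:
  assumes l: "1 \<le> l" "l \<le> n" and G: "complete_bipartite_digraph n (n + l) G"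
  shows "strong_equitable_vertex_arboricity 2 G \<le> 2 * ((n + l + 1) div 3)"
proof -
  obtain U V where gr: "graph G" and UV: "verts G = U \<union> V" "U \<inter> V = {}"
      "arcs_ends G \<subseteq> U \<times> V \<union> V \<times> U" "card U = n" "card V = n + l"
    using G by (auto simp: complete_bipartite_digraph_def)
  interpret graph G by fact
  have N: "card (verts G) = 2 * n + l"
    using UV finite_verts by (simp add: card_Un_disjoint)
  have "\<exists>f. tree_coloring G t 2 f \<and> equitable G t f" if t: "2 * ((n + l + 1) div 3) \<le> t" for t
  proof (cases "2 * n + l \<le> 3 * t")
    case True
    then show ?thesis
      using l N by (intro equitable_tree_coloring_if_small_classes[OF gr UV(2,3)]) auto
  next
    case False
    define m where "m = (n + l + 1) div 3"
    have "3 * m \<le> n + l + 1" "n + l + 1 \<le> 3 * m + 2"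
      unfolding m_def by linarith+
    moreover have "2 * m \<le> t" using t by (simp add: m_def)
    \<comment> \<open>Here \<open>2 * n + 2 * l\<close> \<le> \<open>6 * m + 2\<close> \<le>
      \<open>3 * t + 2\<close> and \<open>3 * t < 2 * n + l\<close>, so \<open>l < 2\<close>. With
      \<open>l = 1\<close> the same chain forces \<open>n = 3 * m\<close> and
      \<open>t = 2 * m\<close>.\<close>
    ultimately have "l = 1" "n = 3 * m" "t = 2 * m"
      using False l(1) by linarith+
    \<comment> \<open>The choice \<open>q = 3\<close> fits both sides because \<open>m\<close> is
      positive, so that \<open>3 * m + 1\<close> \<le> \<open>4 * m\<close>.\<close>
    then show ?thesis
      using equitable_tree_coloring_if_independent_classes[OF gr UV(1-3), of m 3] UV(4,5) l
      by simp
  qed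
  moreover have "0 < 2 * ((n + l + 1) div 3)"
    using l by auto
  ultimately show ?thesis
    unfolding strong_equitable_vertex_arboricity_def by (intro Least_le) blast
qed

section \<open>Sharpness\<close>

text \<open>Arcs are ordered pairs of vertices, both orientations of each edge being present, so an
  arc coincides with its pair of ends.\<close>

definition complete_bipartite_pair_digraph :: "'a set \<Rightarrow> 'a set \<Rightarrow> ('a, 'a \<times> 'a) pre_digraph" where
  "complete_bipartite_pair_digraph U V =
     with_proj \<lparr>pverts = U \<union> V, parcs = U \<times> V \<union> V \<times> U\<rparr>"

lemma complete_bipartite_pair_digraph:
  assumes "finite U" "finite V" "U \<inter> V = {}"
  shows "complete_bipartite_digraph (card U) (card V) (complete_bipartite_pair_digraph U V)"
  using assms unfolding complete_bipartite_pair_digraph_def complete_bipartite_digraph_pair_def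
  by auto

text \<open>With one color the whole graph is a single component, and a vertex of \<open>U\<close>
  has out-degree \<open>card V\<close>, exceeding \<open>k\<close>.\<close>

lemma no_monochromatic_tree_coloring:
  assumes UV: "finite U" "finite V" "U \<inter> V = {}" "U \<noteq> {}" "k < card V"
  shows "\<not> tree_coloring (complete_bipartite_pair_digraph U V) 1 k f"
proof
  let ?G = "complete_bipartite_pair_digraph U V"
  assume col: "tree_coloring ?G 1 k f"
  interpret graph ?G
    using complete_bipartite_pair_digraph[OF UV(1-3)] by (simp add: complete_bipartite_digraph_def)
  have verts: "verts ?G = U \<union> V" and ends: "arcs_ends ?G = U \<times> V \<union> V \<times> U"
    by (auto simp: complete_bipartite_pair_digraph_def)
  \<comment> \<open>These serve as hubs: \<open>V\<close> is adjacent to \<open>u\<close>, and the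
    rest of \<open>U\<close> is linked to \<open>u\<close> through \<open>v\<close>.\<close>
  obtain u v where uv: "u \<in> U" "v \<in> V" using UV(4,5) by fastforce
  have adj: "x \<rightarrow>\<^sup>*\<^bsub>?G\<^esub> y" if "(x, y) \<in> U \<times> V \<union> V \<times> U" for x y
    using that ends by (intro reachable_adjI) auto
  have "x \<rightarrow>\<^sup>*\<^bsub>?G\<^esub> y" if "x \<in> verts ?G" "y \<in> verts ?G" for x y
  proof -
    have "x \<rightarrow>\<^sup>*\<^bsub>?G\<^esub> u"
      using that(1) uv adj[of x u] adj[of x v] adj[of v u] verts by (auto intro: reachable_trans)
    moreover have "u \<rightarrow>\<^sup>*\<^bsub>?G\<^esub> y"
      using that(2) uv adj[of u y] adj[of v y] adj[of u v] verts by (auto intro: reachable_trans)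
    ultimately show ?thesis by (rule reachable_trans)
  qed
  then have "strongly_connected ?G"
    using uv verts by (auto simp: strongly_connected_def)
  then have "?G \<in> sccs"
    using induced_subgraph_refl by (intro in_sccsI) (auto simp: induced_subgraph_def subgraph_def)
  moreover have "color_class ?G f 1 = verts ?G"
    using col by (auto simp: tree_coloring_def coloring_def color_class_def)
  moreover have "?G \<restriction> verts ?G = ?G"
    by (auto simp: complete_bipartite_pair_digraph_def induce_subgraph_def with_proj_def)
  ultimately have "out_degree ?G u \<le> k"
    using col uv verts by (auto simp: tree_coloring_def)
  moreover have "out_arcs ?G u = {u} \<times> V"
    using uv UV(3) by (auto simp: complete_bipartite_pair_digraph_def out_arcs_def)
  ultimately show False
    using UV(5) by (simp add: out_degree_def card_cartesian_product)
qed

theorem theorem2p1: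
  shows "(\<forall>(n::nat) (l::nat) (G :: ('a, 'b) pre_digraph).
            1 \<le> l \<and> l \<le> n \<and> complete_bipartite_digraph n (n + l) G \<longrightarrow>
            strong_equitable_vertex_arboricity 2 G \<le> 2 * ((n + l + 1) div 3)) \<and>
         (\<exists>(n::nat) (l::nat) (G :: (nat, nat \<times> nat) pre_digraph).
            1 \<le> l \<and> l \<le> n \<and> complete_bipartite_digraph n (n + l) G \<and>
            strong_equitable_vertex_arboricity 2 G = 2 * ((n + l + 1) div 3))"
proof (intro conjI allI impI)
  fix n l :: nat and G :: "('a, 'b) pre_digraph"
  assume "1 \<le> l \<and> l \<le> n \<and> complete_bipartite_digraph n (n + l) G"
  then show "strong_equitable_vertex_arboricity 2 G \<le> 2 * ((n + l + 1) div 3)"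
    using strong_equitable_vertex_arboricity_complete_bipartite_le by blast
next
  \<comment> \<open>For \<open>n = 2\<close> and \<open>l = 1\<close> the bound equals 2, so only
    the value 1 has to be excluded.\<close>
  let ?G = "complete_bipartite_pair_digraph {0, 1} {2, 3, 4 :: nat}"
  let ?P = "\<lambda>t. 0 < t \<and> (\<forall>t' \<ge> t. \<exists>f. tree_coloring ?G t' 2 f \<and> equitable ?G t' f)"
  have K: "complete_bipartite_digraph 2 (2 + 1) ?G"
    using complete_bipartite_pair_digraph[of "{0, 1}" "{2, 3, 4 :: nat}"]
    by (simp add: numeral_2_eq_2 numeral_3_eq_3)
  then have "graph ?G" by (simp add: complete_bipartite_digraph_def)
  then have "\<exists>t. ?P t"
    using strong_equitable_vertex_arboricity_exists by blast
  then have P: "?P (strong_equitable_vertex_arboricity 2 ?G)"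
    unfolding strong_equitable_vertex_arboricity_def by (rule LeastI_ex)
  have "\<not> tree_coloring ?G 1 2 f" for f
    by (rule no_monochromatic_tree_coloring) auto
  \<comment> \<open>The value 1 would require a one-color tree-coloring, the instance
    \<open>t' = 1\<close> of \<open>?P\<close>.\<close>
  with P have "strong_equitable_vertex_arboricity 2 ?G \<noteq> 1"
    by fastforce
  with P strong_equitable_vertex_arboricity_complete_bipartite_le[OF _ _ K]
  have "strong_equitable_vertex_arboricity 2 ?G = 2 * ((2 + 1 + 1) div 3)"
    by simp
  with K show "\<exists>(n::nat) (l::nat) (G :: (nat, nat \<times> nat) pre_digraph).
      1 \<le> l \<and> l \<le> n \<and> complete_bipartite_digraph n (n + l) G \<and>
      strong_equitable_vertex_arboricity 2 G = 2 * ((n + l + 1) div 3)"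
    by (intro exI[of _ 2] exI[of _ 1] exI[of _ ?G]) simp
qed

end
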